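(* $\left\{(r_0,r_1)\in\mathbb{R}^2 \mid r_0-r_1>-\tfrac12,\ r_1\ge\max\{-2\sqrt{r_0},-r_0\},\ r_0>\tfrac32+\sqrt2\right\}\subset\mathcal{D}_2^{( * )}$.
   Context: For $\mathbf{r}=(r_0,r_1)\in\mathbb{R}^2$, the two-dimensional shift radix system is the map $\tau_{\mathbf{r}}:\mathbb{Z}^2\to\mathbb{Z}^2$, $\tau_{\mathbf{r}}(a_0,a_1)=(a_1,-\lfloor r_0a_0+r_1a_1\rfloor)$. The orbit of $(a_0,a_1)$ is identified with the integer sequence $(a_n)_{n\ge 0}$ where $a_{n+2}=-\lfloor r_0a_n+r_1a_{n+1}\rfloor$ for $n\ge0$. An orbit is ultimately periodic if there are $n_0\ge 0$, $p>0$ with $a_{n+p}=a_n$ for all $n\ge n_0$; it ends up in the trivial cycle if $a_n=0$ for all sufficiently large $n$. $\mathcal{D}_2^{( * )}$ is the set of all $\mathbf{r}\in\mathbb{R}^2$ such that each ultimately periodic orbit of $\tau_{\mathbf{r}}$ ends up in the trivial cycle. *)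

theory Defs
  imports Complex_Main
begin

definition srs :: "real \<times> real \<Rightarrow> int \<times> int \<Rightarrow> int \<times> int" where
  "srs r a = (snd a, - \<lfloor>fst r * of_int (fst a) + snd r * of_int (snd a)\<rfloor>)"

text \<open>The orbit of \<open>(a\<^sub>0, a\<^sub>1)\<close> is identified with the integer sequence of the first
  components of its points; \<open>srs_funpow_eq\<close> and \<open>srs_orbit_Suc_Suc\<close> justify this.\<close>

definition srs_orbit :: "real \<times> real \<Rightarrow> int \<times> int \<Rightarrow> nat \<Rightarrow> int" where
  "srs_orbit r a n = fst ((srs r ^^ n) a)"

lemma srs_funpow_eq: "(srs r ^^ n) a = (srs_orbit r a n, srs_orbit r a (Suc n))"
  by (simp add: srs_orbit_def srs_def)

lemma srs_orbit_0 [simp]: "srs_orbit r a 0 = fst a"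
  by (simp add: srs_orbit_def)

lemma srs_orbit_1 [simp]: "srs_orbit r a (Suc 0) = snd a"
  by (simp add: srs_orbit_def srs_def)

lemma srs_orbit_Suc_Suc:
  "srs_orbit r a (Suc (Suc n)) =
     - \<lfloor>fst r * of_int (srs_orbit r a n) + snd r * of_int (srs_orbit r a (Suc n))\<rfloor>"
  by (simp add: srs_orbit_def srs_def)

definition ultimately_periodic :: "(nat \<Rightarrow> 'a) \<Rightarrow> bool" where
  "ultimately_periodic x \<longleftrightarrow> (\<exists>n0. \<exists>p>0. \<forall>n\<ge>n0. x (n + p) = x n)"

definition ends_in_trivial_cycle :: "(nat \<Rightarrow> int) \<Rightarrow> bool" where
  "ends_in_trivial_cycle x \<longleftrightarrow> (\<exists>n0. \<forall>n\<ge>n0. x n = 0)"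

definition D2_star :: "(real \<times> real) set" where
  "D2_star = {r. \<forall>a. ultimately_periodic (srs_orbit r a) \<longrightarrow> ends_in_trivial_cycle (srs_orbit r a)}"

end

theory Submission
  imports Defs
begin

text \<open>
  Let \<open>c\<^sub>k\<close> be the coefficients of the power series \<open>1 / (r\<^sub>0 + r\<^sub>1 z + z\<^sup>2)\<close>. Every orbit satisfies
  \<open>r\<^sub>0 a\<^sub>n + r\<^sub>1 a\<^sub>n\<^sub>+\<^sub>1 + a\<^sub>n\<^sub>+\<^sub>2 = \<delta>\<^sub>n\<close> with \<open>0 \<le> \<delta>\<^sub>n < 1\<close>, so a bounded orbit is given by
  \<open>a\<^sub>n = \<Sum>\<^sub>k c\<^sub>k \<delta>\<^sub>n\<^sub>+\<^sub>k\<close>. Centring \<open>\<delta>\<close> at \<open>1/2\<close> shows that \<open>a\<^sub>n\<close> has distance at most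
  \<open>(\<Sum>\<bar>c\<^sub>k\<bar>) / 2\<close> from \<open>(\<Sum>c\<^sub>k) / 2\<close>, where \<open>\<Sum>c\<^sub>k = 1 / (1 + r\<^sub>0 + r\<^sub>1)\<close> lies in \<open>(0, 1]\<close>.
  Moreover \<open>\<Sum>\<bar>c\<^sub>k\<bar> < 2\<close>: if \<open>\<bar>r\<^sub>1\<bar> \<le> 2\<surd>r\<^sub>0\<close>, the sum is at most \<open>1 / (\<surd>r\<^sub>0 - 1)\<^sup>2\<close>, which is less
  than 2 exactly when \<open>r\<^sub>0 > 3/2 + \<surd>2\<close>; if \<open>r\<^sub>1 > 2\<surd>r\<^sub>0\<close>, the signs of the \<open>c\<^sub>k\<close> alternate and the sum
  is \<open>1 / (1 + r\<^sub>0 - r\<^sub>1)\<close>. Hence all \<open>a\<^sub>n\<close> lie in \<open>{0, 1}\<close>, and a term equal to 1 would force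
  a negative one soon after.
\<close>

section \<open>The kernel: recursion, sum and invariant form\<close>

fun kernel :: "real \<Rightarrow> real \<Rightarrow> nat \<Rightarrow> real" where
  "kernel r0 r1 0 = 1 / r0"
| "kernel r0 r1 (Suc 0) = - r1 / r0\<^sup>2"
| "kernel r0 r1 (Suc (Suc k)) = - (r1 * kernel r0 r1 (Suc k) + kernel r0 r1 k) / r0"

lemma kernel_rec:
  assumes "r0 \<noteq> 0"
  shows "r0 * kernel r0 r1 (Suc (Suc k)) = - r1 * kernel r0 r1 (Suc k) - kernel r0 r1 k"
  using assms by simp

text \<open>This is the generating function at \<open>z = 1\<close>: summing the recursion over all
  \<open>k\<close> leaves a linear equation for the sum.\<close>

lemma kernel_sums:
  assumes "r0 \<noteq> 0" "1 + r0 + r1 \<noteq> 0" "summable (kernel r0 r1)"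
  shows "suminf (kernel r0 r1) = 1 / (1 + r0 + r1)"
proof -
  define c where "c = kernel r0 r1"
  have sc: "summable c" "summable (\<lambda>k. c (Suc k))" "summable (\<lambda>k. c (Suc (Suc k)))"
    using assms(3) summable_Suc_iff[of c] summable_Suc_iff[of "\<lambda>k. c (Suc k)"]
    by (simp_all add: c_def del: kernel.simps)
  have 1: "(\<Sum>k. c (Suc k)) = suminf c - c 0"
    using suminf_split_head[OF sc(1)] .
  have 2: "(\<Sum>k. c (Suc (Suc k))) = suminf c - c 0 - c 1"
    using suminf_split_head[OF sc(2)] 1 by simp
  have "r0 * (\<Sum>k. c (Suc (Suc k))) = (\<Sum>k. r0 * c (Suc (Suc k)))"
    by (rule suminf_mult[symmetric, OF sc(3)])
  also have "\<dots> = (\<Sum>k. - r1 * c (Suc k) - c k)"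
    using kernel_rec[OF assms(1)] by (simp add: c_def del: kernel.simps)
  also have "\<dots> = - r1 * (\<Sum>k. c (Suc k)) - suminf c"
    using suminf_diff[OF summable_mult[OF sc(2), of "- r1"] sc(1)] suminf_mult[OF sc(2), of "- r1"]
    by simp
  finally have "r0 * (suminf c - c 0 - c 1) = - r1 * (suminf c - c 0) - suminf c"
    unfolding 1 2 .
  moreover have "r0 * c 0 = 1" "r0 * c 1 = - r1 * c 0"
    using assms(1) by (simp_all add: c_def power2_eq_square)
  ultimately have "(1 + r0 + r1) * suminf c = 1"
    by (simp add: algebra_simps)
  then show ?thesis
    using assms(2) by (simp add: c_def field_simps)
qed

text \<open>The quadratic form on the left is multiplied by \<open>1 / r\<^sub>0\<close> in each step of the recursion.\<close>

lemma kernel_quadratic_form: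
  fixes r0 r1 :: real
  assumes "r0 \<noteq> 0"
  defines "c \<equiv> kernel r0 r1"
  shows "r0 * (c (Suc k))\<^sup>2 + r1 * c k * c (Suc k) + (c k)\<^sup>2 = 1 / r0 ^ (k + 2)"
proof (induction k)
  case 0
  then show ?case
    using assms(1) by (simp add: c_def field_simps power2_eq_square)
next
  case (Suc k)
  have rec: "r0 * c (Suc (Suc k)) = - r1 * c (Suc k) - c k"
    unfolding c_def by (rule kernel_rec[OF assms(1)])
  define x y z where "x = c k" and "y = c (Suc k)" and "z = c (Suc (Suc k))"
  have r: "r0 * z = - r1 * y - x"
    using rec by (simp add: x_def y_def z_def)
  have "r0 * (r0 * z\<^sup>2 + r1 * y * z + y\<^sup>2) = (r0 * z)\<^sup>2 + r1 * y * (r0 * z) + r0 * y\<^sup>2"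
    by (simp add: algebra_simps power2_eq_square)
  also have "\<dots> = r0 * y\<^sup>2 + r1 * x * y + x\<^sup>2"
    unfolding r by (simp add: algebra_simps power2_eq_square)
  also have "\<dots> = 1 / r0 ^ (k + 2)"
    using Suc.IH by (simp add: x_def y_def)
  finally have "r0 * z\<^sup>2 + r1 * y * z + y\<^sup>2 = 1 / r0 ^ (k + 2) / r0"
    using assms(1) by (simp add: field_simps)
  then show ?case
    by (simp add: x_def y_def z_def)
qed

section \<open>Absolute sum of the kernel for \<open>\<bar>r1\<bar> \<le> 2 * s\<close>\<close>

text \<open>The bound is the kernel itself in the double root case \<open>r1 = - 2 * s\<close>,
  where the series is \<open>1 / (s - z)\<^sup>2\<close>.\<close>

lemma abs_kernel_le:
  assumes "s > 0" "\<bar>r1\<bar> \<le> 2 * s"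
  shows "\<bar>kernel (s\<^sup>2) r1 k\<bar> \<le> real (Suc k) * (1 / s) ^ (k + 2)"
proof (induction k)
  case 0
  show ?case
    using assms(1) by (simp add: power2_eq_square)
next
  case (Suc k)
  define x y q where "x = kernel (s\<^sup>2) r1 k" and "y = kernel (s\<^sup>2) r1 (Suc k)" and "q = r1 / (2 * s)"
  have q: "\<bar>q\<bar> \<le> 1" and r1: "r1 = 2 * s * q"
    using assms by (simp_all add: q_def)
  have "(s * y + q * x)\<^sup>2 + (1 - q\<^sup>2) * x\<^sup>2 = s\<^sup>2 * y\<^sup>2 + r1 * x * y + x\<^sup>2"
    by (simp add: r1 algebra_simps power2_eq_square)
  also have "\<dots> = 1 / (s\<^sup>2) ^ (k + 2)"
    using kernel_quadratic_form[of "s\<^sup>2" r1 k] assms(1) unfolding x_def y_def by simp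
  also have "\<dots> = ((1 / s) ^ (k + 2))\<^sup>2"
    by (simp only: power_one_over power_mult[symmetric] mult.commute)
  finally have eq: "(s * y + q * x)\<^sup>2 + (1 - q\<^sup>2) * x\<^sup>2 = ((1 / s) ^ (k + 2))\<^sup>2" .
  have "0 \<le> (1 - q\<^sup>2) * x\<^sup>2"
    using q by (simp add: abs_square_le_1)
  with eq have "(s * y + q * x)\<^sup>2 \<le> ((1 / s) ^ (k + 2))\<^sup>2"
    by linarith
  then have "\<bar>s * y + q * x\<bar> \<le> (1 / s) ^ (k + 2)"
    by (rule abs_le_square_iff[THEN iffD2, THEN order_trans]) (use assms(1) in simp)
  moreover have "\<bar>q * x\<bar> \<le> \<bar>x\<bar>"
    using mult_right_mono[OF q, of "\<bar>x\<bar>"] by (simp add: abs_mult)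
  moreover have "\<bar>x\<bar> \<le> real (Suc k) * (1 / s) ^ (k + 2)"
    using Suc.IH by (simp add: x_def)
  ultimately have "\<bar>s * y\<bar> \<le> real (Suc k) * (1 / s) ^ (k + 2) + (1 / s) ^ (k + 2)"
    by linarith
  also have "\<dots> = s * (real (Suc (Suc k)) * (1 / s) ^ (Suc k + 2))"
    using assms(1) by (simp add: field_simps)
  finally have "s * \<bar>y\<bar> \<le> s * (real (Suc (Suc k)) * (1 / s) ^ (Suc k + 2))"
    using assms(1) by (simp add: abs_mult)
  then show ?case
    using assms(1) unfolding y_def by (simp only: mult_le_cancel_left_pos)
qed

lemma kernel_abs_sum_le:
  assumes "s > 1" "\<bar>r1\<bar> \<le> 2 * s"
  shows "summable (\<lambda>k. \<bar>kernel (s\<^sup>2) r1 k\<bar>)" "(\<Sum>k. \<bar>kernel (s\<^sup>2) r1 k\<bar>) \<le> 1 / (s - 1)\<^sup>2"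
proof -
  have "(\<lambda>k. of_nat (Suc k) * (1 / s) ^ k) sums (1 / (1 - 1 / s)\<^sup>2)"
    using assms(1) by (intro geometric_deriv_sums) simp
  from sums_mult[OF this, of "(1 / s)\<^sup>2"]
  have S: "(\<lambda>k. real (Suc k) * (1 / s) ^ (k + 2)) sums ((1 / s)\<^sup>2 * (1 / (1 - 1 / s)\<^sup>2))"
    by (simp only: power_add mult_ac)
  have eq: "(1 / s)\<^sup>2 * (1 / (1 - 1 / s)\<^sup>2) = 1 / (s - 1)\<^sup>2"
  proof -
    have "(s - 1)\<^sup>2 = s\<^sup>2 * (1 - 1 / s)\<^sup>2"
      using assms(1) by (simp add: power_mult_distrib[symmetric] right_diff_distrib)
    then show ?thesis
      by (simp add: power_divide)
  qed
  have le: "\<bar>kernel (s\<^sup>2) r1 k\<bar> \<le> real (Suc k) * (1 / s) ^ (k + 2)" for k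
    using abs_kernel_le assms by simp
  show *: "summable (\<lambda>k. \<bar>kernel (s\<^sup>2) r1 k\<bar>)"
    by (rule summable_comparison_test'[OF sums_summable[OF S], of 0]) (use le in simp)
  show "(\<Sum>k. \<bar>kernel (s\<^sup>2) r1 k\<bar>) \<le> 1 / (s - 1)\<^sup>2"
    using suminf_le[OF le * sums_summable[OF S]] sums_unique[OF S] eq by simp
qed

section \<open>Absolute sum of the kernel in the alternating case\<close>

lemma kernel_uminus: "kernel r0 (- r1) k = (- 1) ^ k * kernel r0 r1 k"
  by (induction r0 r1 k rule: kernel.induct) (simp_all add: algebra_simps diff_divide_distrib)

text \<open>Positivity alone does not survive the subtraction in the recursion. The ratio bound
  carries it: \<open>r1 * y - x\<close> is at least \<open>2 * s * y - s * y\<close>.\<close>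

lemma kernel_pos_mono:
  assumes "s > 0" "2 * s \<le> r1"
  shows "0 < kernel (s\<^sup>2) (- r1) k \<and> kernel (s\<^sup>2) (- r1) k \<le> s * kernel (s\<^sup>2) (- r1) (Suc k)"
proof (induction k)
  case 0
  have "s * s \<le> s * r1"
    using assms by (intro mult_left_mono) auto
  then show ?case
    using assms by (simp add: field_simps power2_eq_square)
next
  case (Suc k)
  define x y z where "x = kernel (s\<^sup>2) (- r1) k" and "y = kernel (s\<^sup>2) (- r1) (Suc k)"
    and "z = kernel (s\<^sup>2) (- r1) (Suc (Suc k))"
  have x: "0 < x" "x \<le> s * y"
    using Suc.IH by (simp_all add: x_def y_def)
  then have y: "0 < y"
    using assms(1) by (metis less_le_trans zero_less_mult_pos)
  have "s\<^sup>2 * z = r1 * y - x"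
    using kernel_rec[of "s\<^sup>2" "- r1" k] assms(1) by (simp add: x_def y_def z_def)
  moreover have "2 * s * y \<le> r1 * y"
    using assms y by (intro mult_right_mono) auto
  ultimately have "s * y \<le> s * (s * z)"
    using x by (simp add: power2_eq_square mult.assoc)
  then have "y \<le> s * z"
    using assms(1) by simp
  with y show ?case
    by (simp add: y_def z_def)
qed

lemma kernel_abs_sum_alternating:
  assumes "s \<ge> 1" "2 * s \<le> r1" "r1 < 1 + s\<^sup>2"
  shows "summable (\<lambda>k. \<bar>kernel (s\<^sup>2) r1 k\<bar>)" "(\<Sum>k. \<bar>kernel (s\<^sup>2) r1 k\<bar>) = 1 / (1 + s\<^sup>2 - r1)"
proof -
  define e where "e = kernel (s\<^sup>2) (- r1)"
  have pos: "0 < e k" and mono: "e k \<le> s * e (Suc k)" for k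
    using kernel_pos_mono[of s r1 k] assms by (simp_all add: e_def)
  have abs: "(\<lambda>k. \<bar>kernel (s\<^sup>2) r1 k\<bar>) = e"
  proof
    fix k
    have "\<bar>kernel (s\<^sup>2) r1 k\<bar> = \<bar>e k\<bar>"
      by (simp add: e_def kernel_uminus abs_mult power_abs)
    then show "\<bar>kernel (s\<^sup>2) r1 k\<bar> = e k"
      using pos[of k] by simp
  qed
  have e01: "s\<^sup>2 * e 0 = 1" "s\<^sup>2 * e 1 = r1 * e 0"
    using assms(1) by (simp_all add: e_def field_simps power2_eq_square)
  \<comment> \<open>The recursion summed up to \<open>N\<close>. Its boundary terms
    \<open>s\<^sup>2 * e (Suc N) - e N\<close> are nonnegative by \<open>mono\<close> and
    \<open>s \<ge> 1\<close>, so the partial sums are bounded and the series converges.\<close>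
  have sum_eq: "(1 + s\<^sup>2 - r1) * sum e {..<Suc N} + s\<^sup>2 * e (Suc N) - e N = 1" for N
  proof (induction N)
    case 0
    show ?case
      using e01 by (simp add: algebra_simps)
  next
    case (Suc N)
    have "s\<^sup>2 * e (Suc (Suc N)) = r1 * e (Suc N) - e N"
      using kernel_rec[of "s\<^sup>2" "- r1" N] assms(1) by (simp add: e_def)
    with Suc show ?case
      by (simp add: algebra_simps)
  qed
  have "sum e {..<N} \<le> 1 / (1 + s\<^sup>2 - r1)" for N
  proof -
    have "e N \<le> s * e (Suc N)"
      by (rule mono)
    also have "\<dots> \<le> s\<^sup>2 * e (Suc N)"
      using assms(1) pos[of "Suc N"] by (simp add: power2_eq_square)
    finally have "(1 + s\<^sup>2 - r1) * sum e {..<Suc N} \<le> 1"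
      using sum_eq[of N] by simp
    then have "sum e {..<Suc N} \<le> 1 / (1 + s\<^sup>2 - r1)"
      using assms(3) by (simp add: field_simps)
    then show ?thesis
      using pos[of N] by simp
  qed
  then have "summable e"
    using pos by (intro summableI_nonneg_bounded) (auto intro: less_imp_le)
  then show "summable (\<lambda>k. \<bar>kernel (s\<^sup>2) r1 k\<bar>)"
    "(\<Sum>k. \<bar>kernel (s\<^sup>2) r1 k\<bar>) = 1 / (1 + s\<^sup>2 - r1)"
    using kernel_sums[of "s\<^sup>2" "- r1"] assms by (simp_all add: abs e_def)
qed

section \<open>Bounded orbits\<close>

lemma bounded_recurrence_sums:
  fixes a d :: "nat \<Rightarrow> real"
  assumes "r0 \<noteq> 0" "kernel r0 r1 \<longlonglongrightarrow> 0"
    and rec: "\<And>n. r0 * a n + r1 * a (Suc n) + a (Suc (Suc n)) = d n"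
    and bounded: "\<And>n. \<bar>a n\<bar> \<le> B"
  shows "(\<lambda>k. kernel r0 r1 k * d (n + k)) sums a n"
proof -
  define c where "c = kernel r0 r1"
  \<comment> \<open>When the recurrence is weighted by \<open>c k\<close> and summed, the kernel
    recursion cancels all inner terms. \<open>R N\<close> collects what remains at the upper end; it
    vanishes in the limit since \<open>a\<close> is bounded.\<close>
  define R where "R N = r0 * c (Suc N) * a (n + Suc N) - c N * a (n + Suc (Suc N))" for N
  have eq: "a n = (\<Sum>k<Suc N. c k * d (n + k)) + R N" for N
  proof (induction N)
    case 0
    have "r0 * c 0 = 1" "r0 * c 1 = - r1 * c 0"
      using assms(1) by (simp_all add: c_def power2_eq_square)
    then have "c 0 * d n + R 0 = (r0 * c 0) * a n + (r1 * c 0 + r0 * c 1) * a (Suc n)"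
      unfolding R_def rec[of n, symmetric] by (simp add: algebra_simps)
    with \<open>r0 * c 0 = 1\<close> \<open>r0 * c 1 = - r1 * c 0\<close> show ?case
      by simp
  next
    case (Suc N)
    have "c (Suc N) * d (n + Suc N) + R (Suc N) =
        R N + (r0 * c (Suc (Suc N)) + r1 * c (Suc N) + c N) * a (n + Suc (Suc N))"
      unfolding R_def rec[of "n + Suc N", symmetric] by (simp add: algebra_simps)
    also have "r0 * c (Suc (Suc N)) + r1 * c (Suc N) + c N = 0"
      using kernel_rec[OF assms(1), of r1 N] by (simp add: c_def del: kernel.simps)
    finally have "c (Suc N) * d (n + Suc N) + R (Suc N) = R N"
      by simp
    with Suc show ?case
      by simp
  qed
  have c0: "c \<longlonglongrightarrow> 0" "(\<lambda>N. c (Suc N)) \<longlonglongrightarrow> 0"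
    using assms(2) by (simp_all add: c_def LIMSEQ_Suc del: kernel.simps)
  have null: "(\<lambda>N. u N * a (m N)) \<longlonglongrightarrow> 0" if "u \<longlonglongrightarrow> 0" for u m
    by (rule tendsto_0_le[OF that, of _ B])
      (use bounded in \<open>simp add: abs_mult mult_left_mono\<close>)
  have "R \<longlonglongrightarrow> r0 * 0 - 0"
    unfolding R_def mult.assoc by (intro tendsto_diff tendsto_mult_left null c0)
  then have "(\<lambda>N. a n - R N) \<longlonglongrightarrow> a n"
    by (auto intro: tendsto_eq_intros)
  moreover have "(\<lambda>N. \<Sum>k<Suc N. c k * d (n + k)) = (\<lambda>N. a n - R N)"
    using eq by (metis add_diff_cancel_right')
  ultimately have "(\<lambda>N. \<Sum>k<Suc N. c k * d (n + k)) \<longlonglongrightarrow> a n"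
    by simp
  then show ?thesis
    unfolding sums_def c_def by (rule LIMSEQ_imp_Suc)
qed

lemma ultimately_periodic_bounded:
  fixes x :: "nat \<Rightarrow> int"
  assumes "ultimately_periodic x"
  obtains B where "\<And>n. \<bar>x n\<bar> \<le> B"
proof -
  obtain n0 p where p: "p > 0" and per: "\<And>n. n \<ge> n0 \<Longrightarrow> x (n + p) = x n"
    using assms by (auto simp: ultimately_periodic_def)
  define B where "B = Max ((\<lambda>n. \<bar>x n\<bar>) ` {..<n0 + p})"
  have "\<bar>x n\<bar> \<le> B" for n
  proof (induction n rule: less_induct)
    case (less n)
    show ?case
    proof (cases "n < n0 + p")
      case True
      then show ?thesis
        by (auto simp: B_def intro: Max_ge)
    next
      case False
      then show ?thesis
        using less[of "n - p"] per[of "n - p"] p by simp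
    qed
  qed
  then show ?thesis
    using that by blast
qed

lemma bounded_srs_orbit_01:
  assumes "r0 \<noteq> 0" "r0 + r1 \<ge> 0"
    and summable: "summable (\<lambda>k. \<bar>kernel r0 r1 k\<bar>)" and less: "(\<Sum>k. \<bar>kernel r0 r1 k\<bar>) < 2"
    and bounded: "\<And>n. \<bar>srs_orbit (r0, r1) a n\<bar> \<le> B"
  shows "srs_orbit (r0, r1) a n \<in> {0, 1}"
proof -
  define x where "x n = real_of_int (srs_orbit (r0, r1) a n)" for n
  define d where "d n = frac (r0 * x n + r1 * x (Suc n))" for n
  define c where "c = kernel r0 r1"
  define C where "C = suminf c"
  have c: "summable c"
    using summable_rabs_cancel[OF summable] by (simp add: c_def)
  have C: "0 \<le> C" "C \<le> 1"
    using kernel_sums[of r0 r1] c assms(1,2) by (simp_all add: C_def c_def)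
  have "r0 * x n + r1 * x (Suc n) + x (Suc (Suc n)) = d n" for n
    by (simp add: x_def d_def frac_def srs_orbit_Suc_Suc)
  moreover have "\<bar>x n\<bar> \<le> real_of_int B" for n
    using bounded[of n] unfolding x_def by linarith
  ultimately have "(\<lambda>k. c k * d (n + k)) sums x n"
    unfolding c_def
    by (rule bounded_recurrence_sums[OF assms(1) summable_LIMSEQ_zero[OF c[unfolded c_def]]])
  \<comment> \<open>Centring halves the bound on the weights, from 1 to
    \<open>1 / 2\<close>.\<close>
  from sums_diff[OF this sums_mult2[OF summable_sums[OF c], of "1 / 2"]]
  have S: "(\<lambda>k. c k * (d (n + k) - 1 / 2)) sums (x n - C / 2)"
    by (simp add: C_def algebra_simps)
  have "\<bar>d k - 1 / 2\<bar> \<le> 1 / 2" for k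
    using frac_ge_0[of "r0 * x k + r1 * x (Suc k)"] frac_lt_1[of "r0 * x k + r1 * x (Suc k)"]
    unfolding d_def abs_le_iff by linarith
  then have le: "norm (c k * (d (n + k) - 1 / 2)) \<le> \<bar>c k\<bar> * (1 / 2)" for k
    unfolding real_norm_def abs_mult by (intro mult_left_mono) auto
  have "norm (x n - C / 2) \<le> (\<Sum>k. \<bar>c k\<bar> * (1 / 2))"
    unfolding sums_unique[OF S]
    using le summable by (intro norm_suminf_le summable_mult2) (auto simp: c_def)
  also have "\<dots> = (\<Sum>k. \<bar>c k\<bar>) * (1 / 2)"
    using suminf_mult2[OF summable, of "1 / 2"] by (simp add: c_def)
  also have "\<dots> < 1"
    using less by (simp add: c_def)
  finally have "\<bar>x n - C / 2\<bar> < 1"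
    by simp
  \<comment> \<open>Here \<open>C / 2\<close> lies between 0 and \<open>1 / 2\<close>.\<close>
  with C have "- 1 < x n" "x n < 2"
    by linarith+
  then show ?thesis
    unfolding x_def by auto
qed

text \<open>A 1 followed by 0 yields the negative term \<open>- \<lfloor>r0\<rfloor>\<close>, so a 1
  is followed by 1 forever; but two ones yield
  \<open>- \<lfloor>r0 + r1\<rfloor> \<le> 0\<close>.\<close>

lemma srs_orbit_01_imp_0:
  assumes "r0 \<ge> 1" "r0 + r1 \<ge> 0" and x01: "\<And>n. srs_orbit (r0, r1) a n \<in> {0, 1}"
  shows "srs_orbit (r0, r1) a n = 0"
proof (rule ccontr)
  define x where "x = srs_orbit (r0, r1) a"
  have rec: "x (Suc (Suc n)) = - \<lfloor>r0 * of_int (x n) + r1 * of_int (x (Suc n))\<rfloor>" for n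
    by (simp add: x_def srs_orbit_Suc_Suc)
  have no10: "x (Suc n) = 1" if "x n = 1" for n
  proof (rule ccontr)
    assume "x (Suc n) \<noteq> 1"
    then have "x (Suc n) = 0"
      using x01[of "Suc n"] by (simp add: x_def)
    with that rec[of n] have "x (Suc (Suc n)) = - \<lfloor>r0\<rfloor>"
      by simp
    moreover have "\<lfloor>r0\<rfloor> \<ge> 1"
      using assms(1) by simp
    ultimately show False
      using x01[of "Suc (Suc n)"] unfolding x_def by (smt (verit) insertE singletonD)
  qed
  assume "srs_orbit (r0, r1) a n \<noteq> 0"
  then have "x n = 1"
    using x01[of n] by (simp add: x_def)
  then have "x (Suc n) = 1" "x (Suc (Suc n)) = 1"
    using no10 by blast+
  with \<open>x n = 1\<close> rec[of n] have "\<lfloor>r0 + r1\<rfloor> = - 1"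
    by simp
  moreover have "\<lfloor>r0 + r1\<rfloor> \<ge> 0"
    using assms(2) by simp
  ultimately show False
    by linarith
qed

theorem theorem5:
  shows "{(r0 :: real, r1 :: real).
            r0 - r1 > - (1 / 2) \<and> r1 \<ge> max (- 2 * sqrt r0) (- r0) \<and> r0 > 3 / 2 + sqrt 2}
         \<subseteq> D2_star"
proof clarify
  fix r0 r1 :: real
  assume r1_less: "r0 - r1 > - (1 / 2)" and r1_ge: "r1 \<ge> max (- 2 * sqrt r0) (- r0)"
    and r0: "r0 > 3 / 2 + sqrt 2"
  define s where "s = sqrt r0"
  have "r0 > 1"
    using r0 real_sqrt_ge_zero[of 2] by linarith
  then have r0_eq: "r0 = s\<^sup>2"
    by (simp add: s_def)
  \<comment> \<open>The threshold on \<open>r0\<close> is the square of the point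
    \<open>s > 1\<close> where \<open>1 / (s - 1)\<^sup>2 = 2\<close>.\<close>
  have "(1 + sqrt 2 / 2)\<^sup>2 = 3 / 2 + sqrt 2"
    by (simp add: power2_sum power_divide)
  with r0 have s: "s > 1 + sqrt 2 / 2"
    unfolding s_def by (intro real_less_rsqrt) simp
  then have "s > 1"
    using real_sqrt_gt_zero[of 2] by linarith
  have summable: "summable (\<lambda>k. \<bar>kernel r0 r1 k\<bar>) \<and> (\<Sum>k. \<bar>kernel r0 r1 k\<bar>) < 2"
  proof (cases "r1 \<le> 2 * s")
    case True
    \<comment> \<open>The first entry of the maximum serves here; the second gives
      \<open>r0 + r1 \<ge> 0\<close> for the orbit lemmas below.\<close>
    with r1_ge have r1: "\<bar>r1\<bar> \<le> 2 * s"
      by (simp add: s_def abs_le_iff)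
    have "(sqrt 2 / 2)\<^sup>2 < (s - 1)\<^sup>2"
      using s by (intro power_strict_mono) auto
    then have "1 / (s - 1)\<^sup>2 < 2"
      using \<open>s > 1\<close> by (simp add: power_divide field_simps)
    then show ?thesis
      using kernel_abs_sum_le[OF \<open>s > 1\<close> r1] unfolding r0_eq by auto
  next
    case False
    \<comment> \<open>The hypothesis on \<open>r0 - r1\<close> says that this denominator exceeds
      \<open>1 / 2\<close>.\<close>
    have "1 / (1 + s\<^sup>2 - r1) < 2"
      using r1_less unfolding r0_eq by (simp add: field_simps)
    then show ?thesis
      using kernel_abs_sum_alternating[of s r1] \<open>s > 1\<close> False r1_less unfolding r0_eq by auto
  qed
  have "ends_in_trivial_cycle (srs_orbit (r0, r1) a)"
    if periodic: "ultimately_periodic (srs_orbit (r0, r1) a)" for a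
  proof -
    obtain B where "\<And>n. \<bar>srs_orbit (r0, r1) a n\<bar> \<le> B"
      using ultimately_periodic_bounded[OF periodic] by blast
    then have "srs_orbit (r0, r1) a n \<in> {0, 1}" for n
      using summable \<open>r0 > 1\<close> r1_ge by (intro bounded_srs_orbit_01) auto
    then have "srs_orbit (r0, r1) a n = 0" for n
      using \<open>r0 > 1\<close> r1_ge by (intro srs_orbit_01_imp_0) auto
    then show ?thesis
      by (simp add: ends_in_trivial_cycle_def)
  qed
  then show "(r0, r1) \<in> D2_star"
    by (simp add: D2_star_def)
qed

end
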